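(* Let $f_1,f_2,\dots$ be a sequence of real-valued stochastic processes defined on $[0,1]$ (on a common probability space $\Omega$), such that for every $t\in[0,1]$ the random variables $f_1'(t),f_2'(t),\dots$ are independent. For each integer $n\ge 1$ let $$\phi_n:[0,1]\to\mathbb{R}^n,\qquad t\mapsto \left(\frac{f_1(t)}{\sqrt n},\dots,\frac{f_n(t)}{\sqrt n}\right).$$ Assume that each $\phi_n$ is a stochastic immersion or a mean square smooth process on $(0,1)$, that $\phi_n$ has an expected metric, and that $\phi_n$ is measurable when seen as a map $\Omega\times[0,1]\to\mathbb{R}^n$. Assume that $f_1',f_2',\dots$ has uniformly bounded moments: for every integer $k\ge 1$ there is a constant $C_k$ such that $|\mathbb{E}(f_i'(t)^k)|\le C_k$ for all $i\geq 1$ and all $t\in[0,1]$. Put $$w_n(t)=\|\phi_n'(t)\|,\qquad m_n(t)=\sqrt{\mathbb{E}(w_n(t)^2)},\qquad \Sigma_n(t)=\sqrt{n\cdot \operatorname{var}(w_n(t)^2)},$$ and assume that $\inf_{n\ge 1,\,t\in[0,1]} m_n(t)>0$. Let $$L_n=\int_0^1 \mathbb{E}\left(\|\phi_n'(t)\|^2\right)^{1/2}\,dt,\qquad l_n=\mathbb{E}\left(\int_0^1\|\phi_n'(t)\|\,dt\right)=\int_0^1\mathbb{E}\left(\|\phi_n'(t)\|\right)\,dt$$ be, respectively, the length of $\phi_n$ in the expected metric and the expected length of $\phi_n$. Let $A,b\in\mathbb{R}$ satisfy $\sup_{n,t}\Sigma_n(t)<A$ and $0<b<\inf_{n,t}m_n(t)$.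 Then for all large enough $n$, $$0\le \frac{L_n-l_n}{L_n}\le \frac{A^2}{8nb^4}.$$
   Context: $\|\cdot\|$ is the Euclidean norm, $\mathbb{E}$ is expectation and $\operatorname{var}$ is variance. A stochastic process $\phi$ on an open interval with values in $\mathbb{R}^n$ is a stochastic immersion if all of its sample paths are smooth (infinitely differentiable) and have nowhere vanishing derivative (i.e. Jacobian of full rank everywhere); in this case $\phi'$ is the sample path derivative. The process is mean square smooth if it has mean square derivatives of every order; in this case $\phi'$ (and $f_i'$) denotes the mean square derivative, and the covariance function is taken to be smooth. The process $\phi_n$ has an expected metric if $\mathbb{E}(\|\phi_n'(t)\|^2)$ (the expectation of the $1\times 1$ matrix $J_{\phi_n}^TJ_{\phi_n}$, where $J_{\phi_n}$ is the Jacobian) is a finite smooth function of $t$ that is everywhere positive. Here $\Omega\times[0,1]$ carries the product measure, with Lebesgue measure on $[0,1]$. Under the uniform moment bounds one has $\sup_{n,t}\Sigma_n(t)<\infty$, so such an $A$ exists. *)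

theory Defs
  imports "HOL-Probability.Probability"
begin

text \<open>
  Since the dimension \<open>n\<close> varies inside the statement, a point of \<open>\<real>\<^sup>n\<close> is a function on the
  index set \<open>{1..n}\<close>, extended by \<open>undefined\<close>; its Euclidean norm is \<open>L2_set x {1..n}\<close>, and a
  process with values in \<open>\<real>\<^sup>n\<close> has type \<open>real \<Rightarrow> 'a \<Rightarrow> nat \<Rightarrow> real\<close> (time, outcome, component).
\<close>

abbreviation eucl_norm :: "nat \<Rightarrow> (nat \<Rightarrow> real) \<Rightarrow> real" where
  "eucl_norm n x \<equiv> L2_set x {1..n}"

abbreviation borel_Rn :: "nat \<Rightarrow> (nat \<Rightarrow> real) measure" where
  "borel_Rn n \<equiv> PiM {1..n} (\<lambda>_. borel)"

text \<open>Only meant for open sets \<open>S\<close>: the derivatives are unrestricted.\<close>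

primrec times_differentiable_on ::
  "nat \<Rightarrow> 'a::real_normed_vector set \<Rightarrow> ('a \<Rightarrow> 'b::real_normed_vector) \<Rightarrow> bool" where
  "times_differentiable_on 0 S g \<longleftrightarrow> continuous_on S g"
| "times_differentiable_on (Suc k) S g \<longleftrightarrow> (\<forall>x\<in>S. g differentiable (at x)) \<and>
     (\<forall>v. times_differentiable_on k S (\<lambda>x. frechet_derivative g (at x) v))"

definition smooth_on :: "'a::real_normed_vector set \<Rightarrow> ('a \<Rightarrow> 'b::real_normed_vector) \<Rightarrow> bool" where
  "smooth_on S g \<longleftrightarrow> (\<forall>k. times_differentiable_on k S g)"

definition covariance :: "'a measure \<Rightarrow> ('a \<Rightarrow> real) \<Rightarrow> ('a \<Rightarrow> real) \<Rightarrow> real" where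
  "covariance M X Y = (\<integral>\<omega>. (X \<omega> - (\<integral>\<omega>'. X \<omega>' \<partial>M)) * (Y \<omega> - (\<integral>\<omega>'. Y \<omega>' \<partial>M)) \<partial>M)"

definition stochastic_process_on ::
  "'a measure \<Rightarrow> nat \<Rightarrow> real set \<Rightarrow> (real \<Rightarrow> 'a \<Rightarrow> nat \<Rightarrow> real) \<Rightarrow> bool" where
  "stochastic_process_on M n S X \<longleftrightarrow> (\<forall>t\<in>S. X t \<in> measurable M (borel_Rn n))"

definition stochastic_immersion ::
  "'a measure \<Rightarrow> nat \<Rightarrow> real set \<Rightarrow> (real \<Rightarrow> 'a \<Rightarrow> nat \<Rightarrow> real) \<Rightarrow> bool" where
  "stochastic_immersion M n S X \<longleftrightarrow> stochastic_process_on M n S X \<and>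
     (\<forall>\<omega>\<in>space M. (\<forall>i\<in>{1..n}. smooth_on S (\<lambda>t. X t \<omega> i)) \<and>
        (\<forall>t\<in>S. \<exists>i\<in>{1..n}. deriv (\<lambda>s. X s \<omega> i) t \<noteq> 0))"

definition sample_path_derivative ::
  "'a measure \<Rightarrow> nat \<Rightarrow> real set \<Rightarrow> (real \<Rightarrow> 'a \<Rightarrow> nat \<Rightarrow> real) \<Rightarrow> (real \<Rightarrow> 'a \<Rightarrow> nat \<Rightarrow> real) \<Rightarrow> bool" where
  "sample_path_derivative M n S X X' \<longleftrightarrow>
     (\<forall>\<omega>\<in>space M. \<forall>t\<in>S. \<forall>i\<in>{1..n}. ((\<lambda>s. X s \<omega> i) has_real_derivative X' t \<omega> i) (at t))"

definition second_order_process_on ::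
  "'a measure \<Rightarrow> nat \<Rightarrow> real set \<Rightarrow> (real \<Rightarrow> 'a \<Rightarrow> nat \<Rightarrow> real) \<Rightarrow> bool" where
  "second_order_process_on M n S X \<longleftrightarrow> stochastic_process_on M n S X \<and>
     (\<forall>t\<in>S. integrable M (\<lambda>\<omega>. (eucl_norm n (X t \<omega>))\<^sup>2))"

text \<open>
  Mean square derivatives are unique only up to modification, so the following is a relation.
\<close>

definition mean_square_derivative ::
  "'a measure \<Rightarrow> nat \<Rightarrow> real set \<Rightarrow> (real \<Rightarrow> 'a \<Rightarrow> nat \<Rightarrow> real) \<Rightarrow> (real \<Rightarrow> 'a \<Rightarrow> nat \<Rightarrow> real) \<Rightarrow> bool" where
  "mean_square_derivative M n S X X' \<longleftrightarrow>
     second_order_process_on M n S X \<and> second_order_process_on M n S X' \<and>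
     (\<forall>t\<in>S. ((\<lambda>s. \<integral>\<omega>. (eucl_norm n (\<lambda>i. (X s \<omega> i - X t \<omega> i) / (s - t) - X' t \<omega> i))\<^sup>2 \<partial>M)
        \<longlongrightarrow> 0) (at t within S))"

definition mean_square_smooth ::
  "'a measure \<Rightarrow> nat \<Rightarrow> real set \<Rightarrow> (real \<Rightarrow> 'a \<Rightarrow> nat \<Rightarrow> real) \<Rightarrow> bool" where
  "mean_square_smooth M n S X \<longleftrightarrow>
     (\<exists>D. D 0 = X \<and> (\<forall>k::nat. mean_square_derivative M n S (D k) (D (Suc k)))) \<and>
     (\<forall>i\<in>{1..n}. \<forall>j\<in>{1..n}.
        smooth_on (S \<times> S) (\<lambda>(s, t). covariance M (\<lambda>\<omega>. X s \<omega> i) (\<lambda>\<omega>. X t \<omega> j)))"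

text \<open>The remaining notions take the derivative process \<open>X'\<close>, not \<open>X\<close>, as their argument.\<close>

definition has_expected_metric ::
  "'a measure \<Rightarrow> nat \<Rightarrow> real set \<Rightarrow> (real \<Rightarrow> 'a \<Rightarrow> nat \<Rightarrow> real) \<Rightarrow> bool" where
  "has_expected_metric M n S X' \<longleftrightarrow>
     (\<forall>t\<in>S. integrable M (\<lambda>\<omega>. (eucl_norm n (X' t \<omega>))\<^sup>2)) \<and>
     smooth_on S (\<lambda>t. \<integral>\<omega>. (eucl_norm n (X' t \<omega>))\<^sup>2 \<partial>M) \<and>
     (\<forall>t\<in>S. 0 < (\<integral>\<omega>. (eucl_norm n (X' t \<omega>))\<^sup>2 \<partial>M))"

definition rms_speed :: "'a measure \<Rightarrow> nat \<Rightarrow> (real \<Rightarrow> 'a \<Rightarrow> nat \<Rightarrow> real) \<Rightarrow> real \<Rightarrow> real" where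
  "rms_speed M n X' t = sqrt (\<integral>\<omega>. (eucl_norm n (X' t \<omega>))\<^sup>2 \<partial>M)"

definition scaled_sd :: "'a measure \<Rightarrow> nat \<Rightarrow> (real \<Rightarrow> 'a \<Rightarrow> nat \<Rightarrow> real) \<Rightarrow> real \<Rightarrow> real" where
  "scaled_sd M n X' t = sqrt (real n * prob_space.variance M (\<lambda>\<omega>. (eucl_norm n (X' t \<omega>))\<^sup>2))"

definition expected_metric_length :: "'a measure \<Rightarrow> nat \<Rightarrow> (real \<Rightarrow> 'a \<Rightarrow> nat \<Rightarrow> real) \<Rightarrow> real" where
  "expected_metric_length M n X' =
     (\<integral>t. sqrt (\<integral>\<omega>. (eucl_norm n (X' t \<omega>))\<^sup>2 \<partial>M) \<partial>lebesgue_on {0..1})"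

definition expected_length :: "'a measure \<Rightarrow> nat \<Rightarrow> (real \<Rightarrow> 'a \<Rightarrow> nat \<Rightarrow> real) \<Rightarrow> real" where
  "expected_length M n X' = (\<integral>\<omega>. (\<integral>t. eucl_norm n (X' t \<omega>) \<partial>lebesgue_on {0..1}) \<partial>M)"

text \<open>
  Sends \<open>f\<^sub>1, f\<^sub>2, \<dots>\<close> to the curve \<open>\<phi>\<^sub>n = (f\<^sub>1, \<dots>, f\<^sub>n) / \<surd>n\<close>; applied to the derivatives
  \<open>f\<^sub>1', f\<^sub>2', \<dots>\<close> it gives \<open>\<phi>\<^sub>n'\<close>.
\<close>

definition curve :: "(nat \<Rightarrow> real \<Rightarrow> 'a \<Rightarrow> real) \<Rightarrow> nat \<Rightarrow> real \<Rightarrow> 'a \<Rightarrow> nat \<Rightarrow> real" where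
  "curve f n t \<omega> = (\<lambda>i\<in>{1..n}. f i t \<omega> / sqrt (real n))"

definition jointly_measurable ::
  "'a measure \<Rightarrow> nat \<Rightarrow> (real \<Rightarrow> 'a \<Rightarrow> nat \<Rightarrow> real) \<Rightarrow> bool" where
  "jointly_measurable M n X \<longleftrightarrow>
     (\<lambda>(\<omega>, t). X t \<omega>) \<in> measurable (M \<Otimes>\<^sub>M lebesgue_on {0..1}) (borel_Rn n)"

text \<open>
  What it means for \<open>X'\<close> to be the derivative on \<open>(0,1)\<close> of a process \<open>X\<close> on \<open>[0,1]\<close> that is a
  stochastic immersion or mean square smooth. In the second case a jointly measurable version of
  the mean square derivative is chosen, as integrals of its sample paths depend on the version.
  In the first case joint measurability on \<open>(0,1)\<close> is inherited from \<open>X\<close> and not required.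
  The values of \<open>X'\<close> at the end points are not constrained.
\<close>

definition immersion_derivative ::
  "'a measure \<Rightarrow> nat \<Rightarrow> (real \<Rightarrow> 'a \<Rightarrow> nat \<Rightarrow> real) \<Rightarrow> (real \<Rightarrow> 'a \<Rightarrow> nat \<Rightarrow> real) \<Rightarrow> bool" where
  "immersion_derivative M n X X' \<longleftrightarrow>
     stochastic_immersion M n {0<..<1} X \<and> sample_path_derivative M n {0<..<1} X X'"

definition mean_square_smooth_derivative ::
  "'a measure \<Rightarrow> nat \<Rightarrow> (real \<Rightarrow> 'a \<Rightarrow> nat \<Rightarrow> real) \<Rightarrow> (real \<Rightarrow> 'a \<Rightarrow> nat \<Rightarrow> real) \<Rightarrow> bool" where
  "mean_square_smooth_derivative M n X X' \<longleftrightarrow>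
     mean_square_smooth M n {0<..<1} X \<and> mean_square_derivative M n {0<..<1} X X' \<and>
     jointly_measurable M n X'"

end

theory Submission
  imports Defs
begin

text \<open>
  Write \<open>W = \<parallel>\<phi>\<^sub>n'(t)\<parallel>\<^sup>2\<close>, an average of \<open>n\<close> independent variables, and \<open>\<mu> = E W\<close>. Expanding the square
  root around \<open>\<mu>\<close> gives \<open>E (sqrt W) \<ge> sqrt \<mu> (1 - (1/8 + e) var W / \<mu>\<^sup>2 - E (W - \<mu>)\<^sup>4 / (16 e \<mu>\<^sup>4))\<close> for
  every \<open>e > 0\<close>; the cubic term of the expansion is absorbed by \<open>e\<close> and the quartic one. By
  independence the fourth central moment is \<open>O(1/n\<^sup>2)\<close> uniformly in \<open>t\<close>, while \<open>var W = \<Sigma>\<^sub>n\<^sup>2 / n\<close>, so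
  the strict inequalities on \<open>A\<close> and \<open>b\<close> leave room for a fixed small \<open>e\<close> and for the
  \<open>O(1/n\<^sup>2)\<close> term. Integrating over \<open>t\<close> gives the claim.
\<close>

section \<open>Pointwise expansion of the square root\<close>

text \<open>With \<open>s = sqrt (1 + y)\<close> one has
  \<open>1 + y / 2 - s = (s - 1)^2 / 2\<close> and \<open>y^2 = (s - 1)^2 * (s + 1)^2\<close>.
  Cancelling \<open>(s - 1)^2\<close> leaves \<open>1/2 \<le> (1/8 + e) * (s + 1)^2 + (s - 1)^2 * (s
  + 1)^4 / (16 * e)\<close>. Only \<open>s < 1\<close> is critical, where
  \<open>(s + 1)^2 / 8\<close> falls short of \<open>1/2\<close>.\<close>

lemma sqrt_ge_quartic:
  fixes y e :: real
  assumes "-1 \<le> y" "0 < e"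
  shows "1 + y / 2 - (1/8 + e) * y\<^sup>2 - y ^ 4 / (16 * e) \<le> sqrt (1 + y)"
proof -
  define s where "s = sqrt (1 + y)"
  have s: "0 \<le> s" "y = s\<^sup>2 - 1" using assms by (auto simp: s_def)
  have y2: "y\<^sup>2 = (s - 1)\<^sup>2 * (s + 1)\<^sup>2" unfolding s by algebra
  have "1 \<le> s + 1" using s by simp
  then have s2: "1 \<le> (s + 1)\<^sup>2" and s4: "1 \<le> (s + 1) ^ 4" by (auto intro: one_le_power)
  \<comment> \<open>The square is completed so that its cross term is exactly
    \<open>(s - 1) / 2\<close>, the only possibly negative one; this dictates the coefficient
    \<open>1 / (16 * e)\<close>. The factors \<open>(s + 1)^2\<close> and \<open>(s + 1)^4\<close>
    can then be put in because they are at least 1.\<close>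
  have "0 \<le> (4 * e + (s - 1))\<^sup>2 / (16 * e)" using assms by simp
  also have "\<dots> = e + (s - 1) / 2 + (s - 1)\<^sup>2 / (16 * e)"
    using assms by (simp add: power2_eq_square field_simps)
  also have "\<dots> \<le> e * (s + 1)\<^sup>2 + (s - 1) / 2 + (s - 1)\<^sup>2 / (16 * e) * (s + 1) ^ 4"
  proof -
    have "e * 1 \<le> e * (s + 1)\<^sup>2" using s2 assms by (intro mult_left_mono) auto
    moreover have "(s - 1)\<^sup>2 / (16 * e) * 1 \<le> (s - 1)\<^sup>2 / (16 * e) * (s + 1) ^ 4"
      using s4 assms by (intro mult_left_mono) auto
    ultimately show ?thesis by simp
  qed
  also have "(s - 1) / 2 \<le> (s + 1)\<^sup>2 / 8 - 1/2"
  proof -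
    have "(s + 1)\<^sup>2 / 8 - 1/2 - (s - 1) / 2 = (s - 1)\<^sup>2 / 8" by (simp add: power2_eq_square field_simps)
    moreover have "0 \<le> (s - 1)\<^sup>2 / 8" by simp
    ultimately show ?thesis by linarith
  qed
  finally have "1/2 \<le> (1/8 + e) * (s + 1)\<^sup>2 + (s - 1)\<^sup>2 / (16 * e) * (s + 1) ^ 4"
    by (simp add: algebra_simps)
  then have "(s - 1)\<^sup>2 * (1/2) \<le>
      (s - 1)\<^sup>2 * ((1/8 + e) * (s + 1)\<^sup>2 + (s - 1)\<^sup>2 / (16 * e) * (s + 1) ^ 4)"
    by (intro mult_left_mono) auto
  also have "\<dots> = (1/8 + e) * y\<^sup>2 + (y\<^sup>2)\<^sup>2 / (16 * e)"
    unfolding y2 by (simp add: algebra_simps power_mult_distrib flip: power_mult power_add)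
  finally have "(s - 1)\<^sup>2 * (1/2) \<le> (1/8 + e) * y\<^sup>2 + y ^ 4 / (16 * e)" by simp
  moreover have "1 + y / 2 - s = (s - 1)\<^sup>2 * (1/2)"
    unfolding s by (simp add: power2_eq_square field_simps)
  ultimately show ?thesis unfolding s_def[symmetric] by linarith
qed

section \<open>Moments of sums of independent variables\<close>

lemma (in finite_measure) integrable_power_le:
  fixes X :: "'a \<Rightarrow> real"
  assumes X: "X \<in> borel_measurable M" and int: "integrable M (\<lambda>x. X x ^ n)" and le: "k \<le> n"
  shows "integrable M (\<lambda>x. X x ^ k)"
proof (rule Bochner_Integration.integrable_bound)
  show "integrable M (\<lambda>x. 1 + \<bar>X x ^ n\<bar>)" using int by auto
  show "(\<lambda>x. X x ^ k) \<in> borel_measurable M" using X by measurable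
  show "AE x in M. norm (X x ^ k) \<le> norm (1 + \<bar>X x ^ n\<bar>)"
  proof (rule AE_I2)
    fix x
    have "\<bar>X x\<bar> ^ k \<le> 1 + \<bar>X x\<bar> ^ n"
    proof (cases "\<bar>X x\<bar> \<le> 1")
      case True
      then have "\<bar>X x\<bar> ^ k \<le> 1" by (simp add: power_le_one)
      moreover have "0 \<le> \<bar>X x\<bar> ^ n" by simp
      ultimately show ?thesis by linarith
    next
      case False
      then have "\<bar>X x\<bar> ^ k \<le> \<bar>X x\<bar> ^ n" using le by (intro power_increasing) auto
      then show ?thesis by linarith
    qed
    then show "norm (X x ^ k) \<le> norm (1 + \<bar>X x ^ n\<bar>)" by (simp add: power_abs)
  qed
qed

lemma (in prob_space) square_expectation_le:
  fixes X :: "'a \<Rightarrow> real"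
  assumes "X \<in> borel_measurable M" "integrable M (\<lambda>x. (X x)\<^sup>2)"
  shows "(expectation X)\<^sup>2 \<le> expectation (\<lambda>x. (X x)\<^sup>2)"
proof -
  have "integrable M X"
    using integrable_power_le[OF assms, of 1] by simp
  then show ?thesis
    using variance_eq[OF _ assms(2)] variance_positive[of X] by simp
qed

text \<open>In the expansion of \<open>(Y i + S)^4\<close>, independence and zero means kill every
  term containing a first power, leaving \<open>E Y^4 + 6 * E Y^2 * E S^2 + E S^4\<close>. The
  induction therefore carries the mean and the second moment along with the fourth. It closes
  because \<open>1 + 6 * k + 3 * k^2 \<le> 3 * (k + 1)^2\<close>.\<close>

lemma (in prob_space) fourth_moment_sum_le:
  fixes Y :: "'i \<Rightarrow> 'a \<Rightarrow> real" and c :: real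
  assumes "finite I" and "indep_vars (\<lambda>_. borel) Y I"
    and "\<And>i. i \<in> I \<Longrightarrow> integrable M (\<lambda>\<omega>. Y i \<omega> ^ 4)"
    and "\<And>i. i \<in> I \<Longrightarrow> expectation (Y i) = 0"
    and "\<And>i. i \<in> I \<Longrightarrow> expectation (\<lambda>\<omega>. Y i \<omega> ^ 4) \<le> c"
    and "0 \<le> c"
  shows "integrable M (\<lambda>\<omega>. (\<Sum>i\<in>I. Y i \<omega>) ^ 4) \<and>
    expectation (\<lambda>\<omega>. \<Sum>i\<in>I. Y i \<omega>) = 0 \<and>
    expectation (\<lambda>\<omega>. (\<Sum>i\<in>I. Y i \<omega>)\<^sup>2) \<le> card I * sqrt c \<and>
    expectation (\<lambda>\<omega>. (\<Sum>i\<in>I. Y i \<omega>) ^ 4) \<le> 3 * (card I)\<^sup>2 * c"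
  using assms
proof (induction I rule: finite_induct)
  case empty
  then show ?case by simp
next
  case (insert i I)
  define S where "S = (\<lambda>\<omega>. \<Sum>j\<in>I. Y j \<omega>)"
  have "indep_vars (\<lambda>_. borel) Y I" using insert.prems(1) by (rule indep_vars_subset) auto
  then have IH: "integrable M (\<lambda>\<omega>. S \<omega> ^ 4)" "expectation S = 0"
      "expectation (\<lambda>\<omega>. (S \<omega>)\<^sup>2) \<le> card I * sqrt c"
      "expectation (\<lambda>\<omega>. S \<omega> ^ 4) \<le> 3 * (card I)\<^sup>2 * c"
    using insert.IH insert.prems by (auto simp: S_def)
  have indep: "indep_var borel (Y i) borel S"
    unfolding S_def by (rule indep_vars_sum) (use insert in auto)
  then have m: "Y i \<in> borel_measurable M" "S \<in> borel_measurable M"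
    by (auto dest: indep_var_rv1 indep_var_rv2)
  have iY: "integrable M (\<lambda>\<omega>. Y i \<omega> ^ k)" if "k \<le> 4" for k
    using integrable_power_le[OF m(1) _ that] insert.prems by simp
  have iS: "integrable M (\<lambda>\<omega>. S \<omega> ^ k)" if "k \<le> 4" for k
    using integrable_power_le[OF m(2) IH(1) that] .
  have "indep_var borel ((\<lambda>x. x ^ k) \<circ> Y i) borel ((\<lambda>x. x ^ l) \<circ> S)" for k l :: nat
    using indep by (rule indep_var_compose) auto
  then have ind: "indep_var borel (\<lambda>\<omega>. Y i \<omega> ^ k) borel (\<lambda>\<omega>. S \<omega> ^ l)" for k l :: nat
    by (simp add: comp_def)
  have iYS: "integrable M (\<lambda>\<omega>. Y i \<omega> ^ k * S \<omega> ^ l)" if "k \<le> 4" "l \<le> 4" for k l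
    using indep_var_integrable[OF ind iY iS] that by simp
  have eYS: "expectation (\<lambda>\<omega>. Y i \<omega> ^ k * S \<omega> ^ l) =
      expectation (\<lambda>\<omega>. Y i \<omega> ^ k) * expectation (\<lambda>\<omega>. S \<omega> ^ l)" if "k \<le> 4" "l \<le> 4" for k l
    using indep_var_lebesgue_integral[OF ind iY iS] that by simp
  have Y4: "expectation (\<lambda>\<omega>. Y i \<omega> ^ 4) \<le> c" and Y1: "expectation (Y i) = 0"
    using insert.prems by auto
  \<comment> \<open>Cauchy-Schwarz turns the fourth moment bound \<open>c\<close> into the second
    moment bound \<open>sqrt c\<close>.\<close>
  have "(expectation (\<lambda>\<omega>. (Y i \<omega>)\<^sup>2))\<^sup>2 \<le> expectation (\<lambda>\<omega>. ((Y i \<omega>)\<^sup>2)\<^sup>2)"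
    using m iY[of 4] by (intro square_expectation_le) auto
  also have "\<dots> \<le> c" using Y4 by simp
  finally have Y2: "expectation (\<lambda>\<omega>. (Y i \<omega>)\<^sup>2) \<le> sqrt c" by (rule real_le_rsqrt)
  have "0 \<le> expectation (\<lambda>\<omega>. (Y i \<omega>)\<^sup>2)" "0 \<le> expectation (\<lambda>\<omega>. (S \<omega>)\<^sup>2)" by auto
  then have "expectation (\<lambda>\<omega>. (Y i \<omega>)\<^sup>2) * expectation (\<lambda>\<omega>. (S \<omega>)\<^sup>2) \<le> sqrt c * (card I * sqrt c)"
    using Y2 IH(3) insert.prems(5) by (intro mult_mono) auto
  also have "\<dots> = card I * c" using insert.prems(5) by simp
  finally have YS: "expectation (\<lambda>\<omega>. (Y i \<omega>)\<^sup>2) * expectation (\<lambda>\<omega>. (S \<omega>)\<^sup>2) \<le> card I * c" .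
  have eq: "(\<Sum>j\<in>insert i I. Y j \<omega>) = Y i \<omega> + S \<omega>" for \<omega>
    using insert.hyps by (simp add: S_def)
  \<comment> \<open>The zeroth powers give each summand the shape \<open>Y^k * S^l\<close>, so that
    the one product rule \<open>eYS\<close> covers them all.\<close>
  have eq2: "(Y i \<omega> + S \<omega>)\<^sup>2 = Y i \<omega> ^ 2 * S \<omega> ^ 0 + 2 * (Y i \<omega> ^ 1 * S \<omega> ^ 1) + Y i \<omega> ^ 0 * S \<omega> ^ 2" for \<omega>
    by (simp add: power2_sum)
  have eq4: "(Y i \<omega> + S \<omega>) ^ 4 = Y i \<omega> ^ 4 * S \<omega> ^ 0 + 4 * (Y i \<omega> ^ 3 * S \<omega> ^ 1) +
      6 * (Y i \<omega> ^ 2 * S \<omega> ^ 2) + 4 * (Y i \<omega> ^ 1 * S \<omega> ^ 3) + Y i \<omega> ^ 0 * S \<omega> ^ 4" for \<omega>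
    by (simp add: eval_nat_numeral algebra_simps)
  have i4: "integrable M (\<lambda>\<omega>. (Y i \<omega> + S \<omega>) ^ 4)"
    unfolding eq4 by (intro Bochner_Integration.integrable_add integrable_mult_right iYS) auto
  have e1: "expectation (\<lambda>\<omega>. Y i \<omega> + S \<omega>) = 0"
    using iY[of 1] iS[of 1] IH(2) Y1 by simp
  have "expectation (\<lambda>\<omega>. (Y i \<omega> + S \<omega>)\<^sup>2) =
      expectation (\<lambda>\<omega>. (Y i \<omega>)\<^sup>2) + expectation (\<lambda>\<omega>. (S \<omega>)\<^sup>2)"
    unfolding eq2
    by (simp only: order_refl Bochner_Integration.integral_add Bochner_Integration.integrable_add
          integrable_mult_right integral_mult_right_zero iYS eYS) (simp add: prob_space Y1 IH(2))
  also have "\<dots> \<le> card (insert i I) * sqrt c"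
    using Y2 IH(3) insert.hyps by (simp add: algebra_simps)
  finally have e2: "expectation (\<lambda>\<omega>. (Y i \<omega> + S \<omega>)\<^sup>2) \<le> card (insert i I) * sqrt c" .
  have "expectation (\<lambda>\<omega>. (Y i \<omega> + S \<omega>) ^ 4) = expectation (\<lambda>\<omega>. Y i \<omega> ^ 4) +
      6 * (expectation (\<lambda>\<omega>. (Y i \<omega>)\<^sup>2) * expectation (\<lambda>\<omega>. (S \<omega>)\<^sup>2)) + expectation (\<lambda>\<omega>. S \<omega> ^ 4)"
    unfolding eq4
    by (simp only: order_refl Bochner_Integration.integral_add Bochner_Integration.integrable_add
          integrable_mult_right integral_mult_right_zero iYS eYS) (simp add: prob_space Y1 IH(2))
  also have "\<dots> \<le> c + 6 * (card I * c) + 3 * (card I)\<^sup>2 * c"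
    using Y4 YS IH(4) insert.prems(5) by (auto simp: algebra_simps)
  also have "\<dots> \<le> 3 * (card (insert i I))\<^sup>2 * c"
    using insert.hyps insert.prems(5) by (simp add: algebra_simps power2_eq_square)
  finally show ?case unfolding eq using i4 e1 e2 by simp
qed

section \<open>Joint measurability from continuity in time\<close>

text \<open>
  Approximate \<open>t\<close> by the midpoint of its cell in the uniform partition of mesh \<open>1 / Suc k\<close>; midpoints,
  unlike the cells' left ends, stay inside the open interval.
\<close>

lemma borel_measurable_Caratheodory:
  fixes g :: "real \<Rightarrow> 'a \<Rightarrow> real"
  assumes g: "\<And>t. t \<in> {0<..<1} \<Longrightarrow> g t \<in> borel_measurable M"
    and cont: "\<And>\<omega>. \<omega> \<in> space M \<Longrightarrow> continuous_on {0<..<1} (\<lambda>t. g t \<omega>)"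
  shows "(\<lambda>(t, \<omega>). if t \<in> {0<..<1} then g t \<omega> else 0) \<in> borel_measurable (borel \<Otimes>\<^sub>M M)"
proof (rule borel_measurable_LIMSEQ_real)
  define G where "G = (\<lambda>t \<omega>. if t \<in> {0<..<1} then g t \<omega> else 0)"
  define r where "r = (\<lambda>k t::real. (real_of_int \<lfloor>real (Suc k) * t\<rfloor> + 1/2) / real (Suc k))"
  define h where "h = (\<lambda>k (t, \<omega>). if t \<in> {0<..<1} then G (r k t) \<omega> else 0)"
  \<comment> \<open>The cells are indexed by all integers, so a midpoint may lie outside the
    interval; thanks to the extension by zero every slice of \<open>G\<close> is measurable.\<close>
  have G: "G t \<in> borel_measurable M" for t
    by (cases "t \<in> {0<..<1}") (use g in \<open>auto simp: G_def\<close>)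
  show "h k \<in> borel_measurable (borel \<Otimes>\<^sub>M M)" for k
  proof -
    \<comment> \<open>For a fixed cell the approximant depends on the outcome alone, and the floor
      takes only countably many values, so the cells can be glued together.\<close>
    have "(\<lambda>x. G ((real_of_int i + 1/2) / real (Suc k)) (snd x)) \<in> borel_measurable (borel \<Otimes>\<^sub>M M)" for i
      using G by (rule measurable_compose[OF measurable_snd])
    then have "(\<lambda>x. G ((real_of_int \<lfloor>real (Suc k) * fst x\<rfloor> + 1/2) / real (Suc k)) (snd x))
        \<in> borel_measurable (borel \<Otimes>\<^sub>M M)"
      by (rule measurable_compose_countable) measurable
    then have "(\<lambda>x. if fst x \<in> {0<..<1::real} then
        G ((real_of_int \<lfloor>real (Suc k) * fst x\<rfloor> + 1/2) / real (Suc k)) (snd x) else 0)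
        \<in> borel_measurable (borel \<Otimes>\<^sub>M M)"
      by measurable
    then show ?thesis unfolding h_def r_def case_prod_beta' .
  qed
  show "(\<lambda>k. h k x) \<longlonglongrightarrow> (case x of (t, \<omega>) \<Rightarrow> if t \<in> {0<..<1} then g t \<omega> else 0)"
    if x: "x \<in> space (borel \<Otimes>\<^sub>M M)" for x
  proof -
    obtain t \<omega> where x: "x = (t, \<omega>)" "\<omega> \<in> space M"
      using x by (auto simp: space_pair_measure)
    show ?thesis
    proof (cases "t \<in> {0<..<1}")
      case True
      have r01: "r k t \<in> {0<..<1}" for k
      proof -
        have "0 \<le> real_of_int \<lfloor>real (Suc k) * t\<rfloor>" using True by simp
        moreover have "real (Suc k) * t < real (Suc k) * 1" 
          using True by (intro mult_strict_left_mono) auto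
        then have "\<lfloor>real (Suc k) * t\<rfloor> < int (Suc k)" by (simp add: floor_less_iff)
        then have "real_of_int \<lfloor>real (Suc k) * t\<rfloor> \<le> real (Suc k) - 1" by linarith
        ultimately have "0 < real_of_int \<lfloor>real (Suc k) * t\<rfloor> + 1/2"
            "real_of_int \<lfloor>real (Suc k) * t\<rfloor> + 1/2 < real (Suc k)" by linarith+
        then show ?thesis unfolding r_def by (simp add: divide_less_eq)
      qed
      have "\<bar>r k t - t\<bar> \<le> 1 / real (Suc k)" for k
      proof -
        have "r k t - t = (real_of_int \<lfloor>real (Suc k) * t\<rfloor> + 1/2 - real (Suc k) * t) / real (Suc k)"
          unfolding r_def by (simp add: field_simps)
        moreover have "\<bar>real_of_int \<lfloor>real (Suc k) * t\<rfloor> + 1/2 - real (Suc k) * t\<bar> \<le> 1" by linarith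
        ultimately show ?thesis by (simp add: divide_right_mono)
      qed
      moreover have "(\<lambda>k. 1 / real (Suc k)) \<longlonglongrightarrow> 0"
        using LIMSEQ_inverse_real_of_nat by (simp add: inverse_eq_divide)
      ultimately have "(\<lambda>k. r k t) \<longlonglongrightarrow> t"
        by (intro LIM_zero_cancel[of _ t]) (rule Lim_null_comparison[rotated], auto)
      then have "(\<lambda>k. g (r k t) \<omega>) \<longlonglongrightarrow> g t \<omega>"
        using True r01 by (intro continuous_on_tendsto_compose[OF cont[OF x(2)]]) auto
      then show ?thesis using True r01 by (simp add: x h_def G_def)
    next
      case False
      then show ?thesis unfolding x h_def by auto
    qed
  qed
qed

section \<open>Expectation of a square root, and moments of a mean of squares\<close>

lemma power4_diff_le:
  fixes p q :: real
  shows "(p - q) ^ 4 \<le> 8 * (p ^ 4 + q ^ 4)"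
proof -
  have 1: "(p - q)\<^sup>2 \<le> 2 * (p\<^sup>2 + q\<^sup>2)"
    using zero_le_power2[of "p + q"] by (simp add: power2_eq_square algebra_simps)
  have 2: "(p\<^sup>2 + q\<^sup>2)\<^sup>2 \<le> 2 * (p ^ 4 + q ^ 4)"
    using zero_le_power2[of "p\<^sup>2 - q\<^sup>2"] by (simp add: power2_diff power2_sum)
  have "(p - q) ^ 4 = ((p - q)\<^sup>2)\<^sup>2" by simp
  also have "\<dots> \<le> (2 * (p\<^sup>2 + q\<^sup>2))\<^sup>2" using 1 by (rule power_mono) simp
  also have "\<dots> = 4 * (p\<^sup>2 + q\<^sup>2)\<^sup>2" by algebra
  also have "\<dots> \<le> 8 * (p ^ 4 + q ^ 4)" using 2 by simp
  finally show ?thesis .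
qed

lemma (in prob_space) integrable_sqrt:
  assumes "integrable M W" "\<And>\<omega>. 0 \<le> W \<omega>"
  shows "integrable M (\<lambda>\<omega>. sqrt (W \<omega>))"
proof (rule Bochner_Integration.integrable_bound)
  show "integrable M (\<lambda>\<omega>. 1 + W \<omega>)" using assms by simp
  show "(\<lambda>\<omega>. sqrt (W \<omega>)) \<in> borel_measurable M" using assms(1) by measurable
  have "sqrt x \<le> 1 + x" if "0 \<le> x" for x :: real
    using that by (intro real_le_lsqrt) (auto simp: power2_sum)
  then show "AE \<omega> in M. norm (sqrt (W \<omega>)) \<le> norm (1 + W \<omega>)"
    using assms(2) by auto
qed

text \<open>Jensen's inequality for the square root, obtained from the nonnegative variance of
  \<open>sqrt W\<close>. It yields \<open>l_n \<le> L_n\<close>.\<close>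

lemma (in prob_space) expectation_sqrt_le:
  assumes "integrable M W" "\<And>\<omega>. 0 \<le> W \<omega>"
  shows "expectation (\<lambda>\<omega>. sqrt (W \<omega>)) \<le> sqrt (expectation W)"
proof (rule real_le_rsqrt)
  have "(expectation (\<lambda>\<omega>. sqrt (W \<omega>)))\<^sup>2 \<le> expectation (\<lambda>\<omega>. (sqrt (W \<omega>))\<^sup>2)"
    by (rule square_expectation_le) (use assms integrable_sqrt[OF assms] in auto)
  then show "(expectation (\<lambda>\<omega>. sqrt (W \<omega>)))\<^sup>2 \<le> expectation W"
    using assms(2) by simp
qed

text \<open>The quartic bound is applied to the relative deviation
  \<open>y = (W - \<mu>) / \<mu>\<close>. Its mean is zero, so the linear term disappears on
  integration.\<close>

lemma (in prob_space) expectation_sqrt_ge: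
  fixes W :: "'a \<Rightarrow> real" and e :: real
  defines "\<mu> \<equiv> expectation W"
  assumes W: "integrable M W" "\<And>\<omega>. 0 \<le> W \<omega>"
    and int: "integrable M (\<lambda>\<omega>. (W \<omega> - \<mu>) ^ 4)"
    and "0 < \<mu>" "0 < e"
  shows "sqrt \<mu> * (1 - (1/8 + e) * variance W / \<mu>\<^sup>2 -
      expectation (\<lambda>\<omega>. (W \<omega> - \<mu>) ^ 4) / (16 * e * \<mu> ^ 4)) \<le> expectation (\<lambda>\<omega>. sqrt (W \<omega>))"
proof -
  define y where "y = (\<lambda>\<omega>. (W \<omega> - \<mu>) / \<mu>)"
  have m: "(\<lambda>\<omega>. W \<omega> - \<mu>) \<in> borel_measurable M" using W(1) by measurable
  have i2: "integrable M (\<lambda>\<omega>. (W \<omega> - \<mu>)\<^sup>2)"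
    using integrable_power_le[OF m int, of 2] by simp
  have iy: "integrable M y" unfolding y_def using W(1) by simp
  have iy2: "integrable M (\<lambda>\<omega>. (y \<omega>)\<^sup>2)" unfolding y_def power_divide using i2 by simp
  have iy4: "integrable M (\<lambda>\<omega>. y \<omega> ^ 4)" unfolding y_def power_divide using int by simp
  have "expectation y = 0"
    unfolding y_def using W(1) by (simp add: prob_space \<mu>_def)
  moreover have "expectation (\<lambda>\<omega>. (y \<omega>)\<^sup>2) = variance W / \<mu>\<^sup>2"
    unfolding y_def power_divide by (simp add: \<mu>_def)
  moreover have "expectation (\<lambda>\<omega>. y \<omega> ^ 4) = expectation (\<lambda>\<omega>. (W \<omega> - \<mu>) ^ 4) / \<mu> ^ 4"
    unfolding y_def power_divide by simp
  ultimately have "sqrt \<mu> * (1 - (1/8 + e) * variance W / \<mu>\<^sup>2 -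
      expectation (\<lambda>\<omega>. (W \<omega> - \<mu>) ^ 4) / (16 * e * \<mu> ^ 4)) =
    expectation (\<lambda>\<omega>. sqrt \<mu> * (1 + y \<omega> / 2 - (1/8 + e) * (y \<omega>)\<^sup>2 - y \<omega> ^ 4 / (16 * e)))"
    using iy iy2 iy4 by (simp add: prob_space ac_simps)
  also have "\<dots> \<le> expectation (\<lambda>\<omega>. sqrt (W \<omega>))"
  proof (rule integral_mono)
    show "integrable M (\<lambda>\<omega>. sqrt \<mu> * (1 + y \<omega> / 2 - (1/8 + e) * (y \<omega>)\<^sup>2 - y \<omega> ^ 4 / (16 * e)))"
      using iy iy2 iy4 by simp
    show "integrable M (\<lambda>\<omega>. sqrt (W \<omega>))" using W by (rule integrable_sqrt)
    fix \<omega>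
    \<comment> \<open>Nonnegativity of \<open>W\<close> is exactly the condition under which the
      expansion of \<open>sqrt (1 + y)\<close> holds.\<close>
    have "-1 \<le> y \<omega>" using W(2)[of \<omega>] \<open>0 < \<mu>\<close> by (simp add: y_def field_simps)
    then have "sqrt \<mu> * (1 + y \<omega> / 2 - (1/8 + e) * (y \<omega>)\<^sup>2 - y \<omega> ^ 4 / (16 * e)) \<le> sqrt \<mu> * sqrt (1 + y \<omega>)"
      using \<open>0 < \<mu>\<close> \<open>0 < e\<close> by (intro mult_left_mono sqrt_ge_quartic) auto
    also have "\<dots> = sqrt (W \<omega>)"
      using \<open>0 < \<mu>\<close> by (simp add: y_def field_simps flip: real_sqrt_mult)
    finally show "sqrt \<mu> * (1 + y \<omega> / 2 - (1/8 + e) * (y \<omega>)\<^sup>2 - y \<omega> ^ 4 / (16 * e)) \<le> sqrt (W \<omega>)" .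
  qed
  finally show ?thesis .
qed

text \<open>Fourth central moments of squares call for eighth moments of \<open>X\<close>. The
  centred squares have fourth moment at most \<open>16 * C\<close>, so their sum has fourth moment
  at most \<open>48 * C * n^2\<close>, and the mean picks up a factor \<open>1 / n^4\<close>. All
  bounds depend on \<open>C\<close> and \<open>n\<close> alone, which later makes them uniform in
  time.\<close>

lemma (in prob_space) mean_of_squares_moments:
  fixes X :: "nat \<Rightarrow> 'a \<Rightarrow> real" and C :: real and n :: nat
  defines "W \<equiv> \<lambda>\<omega>. (\<Sum>i=1..n. (X i \<omega>)\<^sup>2) / n"
  assumes indep: "indep_vars (\<lambda>_. borel) X {1..n}" and "1 \<le> n"
    and int: "\<And>i. i \<in> {1..n} \<Longrightarrow> integrable M (\<lambda>\<omega>. X i \<omega> ^ 8)"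
    and le: "\<And>i. i \<in> {1..n} \<Longrightarrow> expectation (\<lambda>\<omega>. X i \<omega> ^ 8) \<le> C"
  shows "integrable M W" "expectation W \<le> 1 + C"
    "integrable M (\<lambda>\<omega>. (W \<omega> - expectation W) ^ 4)"
    "expectation (\<lambda>\<omega>. (W \<omega> - expectation W) ^ 4) \<le> 48 * C / (real n)\<^sup>2"
    "n * variance W \<le> sqrt (48 * C)"
proof -
  have Xm: "X i \<in> borel_measurable M" if "i \<in> {1..n}" for i
    using indep that by (auto simp: indep_vars_def)
  have i2: "integrable M (\<lambda>\<omega>. (X i \<omega>)\<^sup>2)" and i4: "integrable M (\<lambda>\<omega>. X i \<omega> ^ 4)"
    if "i \<in> {1..n}" for i
    using integrable_power_le[OF Xm[OF that] int[OF that]] by auto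
  have "0 \<le> expectation (\<lambda>\<omega>. X 1 \<omega> ^ 8)" by simp
  also have "\<dots> \<le> C" using \<open>1 \<le> n\<close> by (intro le) auto
  finally have "0 \<le> C" .
  define q where "q = (\<lambda>i. expectation (\<lambda>\<omega>. (X i \<omega>)\<^sup>2))"
  define Y where "Y = (\<lambda>i \<omega>. (X i \<omega>)\<^sup>2 - q i)"
  \<comment> \<open>Cauchy-Schwarz is used twice: \<open>q^2 \<le> E X^4\<close> and
    \<open>(E X^4)^2 \<le> E X^8\<close>. The bound \<open>1 + C\<close> covers both
    \<open>q \<le> 1\<close> and \<open>q \<le> q^4 \<le> C\<close>.\<close>
  have q: "q i ^ 4 \<le> C" "q i \<le> 1 + C" if i: "i \<in> {1..n}" for i
  proof -
    have "(q i)\<^sup>2 \<le> expectation (\<lambda>\<omega>. ((X i \<omega>)\<^sup>2)\<^sup>2)"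
      unfolding q_def using Xm[OF i] i4[OF i] by (intro square_expectation_le) auto
    then have "((q i)\<^sup>2)\<^sup>2 \<le> (expectation (\<lambda>\<omega>. X i \<omega> ^ 4))\<^sup>2"
      by (intro power_mono) auto
    also have "\<dots> \<le> expectation (\<lambda>\<omega>. (X i \<omega> ^ 4)\<^sup>2)"
      using Xm[OF i] int[OF i] by (intro square_expectation_le) auto
    also have "\<dots> \<le> C" using le[OF i] by simp
    finally show q4: "q i ^ 4 \<le> C" by simp
    show "q i \<le> 1 + C"
    proof (cases "q i \<le> 1")
      case False
      then have "q i ^ 1 \<le> q i ^ 4" by (intro power_increasing) auto
      then show ?thesis using q4 by simp
    qed (use \<open>0 \<le> C\<close> in simp)
  qed
  have Yint: "integrable M (\<lambda>\<omega>. Y i \<omega> ^ 4)"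
    and Y4: "expectation (\<lambda>\<omega>. Y i \<omega> ^ 4) \<le> 16 * C"
    and Y0: "expectation (Y i) = 0" if i: "i \<in> {1..n}" for i
  proof -
    have b: "Y i \<omega> ^ 4 \<le> 8 * (X i \<omega> ^ 8 + q i ^ 4)" for \<omega>
      using power4_diff_le[of "(X i \<omega>)\<^sup>2" "q i"] by (simp add: Y_def)
    have bi: "integrable M (\<lambda>\<omega>. 8 * (X i \<omega> ^ 8 + q i ^ 4))"
      using int[OF i] by simp
    show "integrable M (\<lambda>\<omega>. Y i \<omega> ^ 4)"
    proof (rule Bochner_Integration.integrable_bound[OF bi])
      show "(\<lambda>\<omega>. Y i \<omega> ^ 4) \<in> borel_measurable M" unfolding Y_def using Xm[OF i] by measurable
      show "AE \<omega> in M. norm (Y i \<omega> ^ 4) \<le> norm (8 * (X i \<omega> ^ 8 + q i ^ 4))"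
        using b by auto
    qed
    then have "expectation (\<lambda>\<omega>. Y i \<omega> ^ 4) \<le> expectation (\<lambda>\<omega>. 8 * (X i \<omega> ^ 8 + q i ^ 4))"
      using bi b by (rule integral_mono)
    also have "\<dots> = 8 * (expectation (\<lambda>\<omega>. X i \<omega> ^ 8) + q i ^ 4)"
      using int[OF i] by (simp add: prob_space)
    also have "\<dots> \<le> 16 * C" using le[OF i] q[OF i] by simp
    finally show "expectation (\<lambda>\<omega>. Y i \<omega> ^ 4) \<le> 16 * C" .
    show "expectation (Y i) = 0" using i2[OF i] by (simp add: Y_def q_def prob_space)
  qed
  have "indep_vars (\<lambda>_. borel) (\<lambda>i \<omega>. (\<lambda>x. x\<^sup>2 - q i) (X i \<omega>)) {1..n}"
    using indep by (rule indep_vars_compose2) auto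
  then have "indep_vars (\<lambda>_. borel) Y {1..n}" by (simp add: Y_def[abs_def])
  then have sum: "integrable M (\<lambda>\<omega>. (\<Sum>i=1..n. Y i \<omega>) ^ 4)"
    "expectation (\<lambda>\<omega>. (\<Sum>i=1..n. Y i \<omega>) ^ 4) \<le> 3 * (real n)\<^sup>2 * (16 * C)"
    using fourth_moment_sum_le[of "{1..n}" Y "16 * C"] Yint Y0 Y4 \<open>0 \<le> C\<close> by auto
  show iW: "integrable M W" unfolding W_def using i2 by (intro integrable_divide Bochner_Integration.integrable_sum)
  have EW: "expectation W = (\<Sum>i=1..n. q i) / n"
    unfolding W_def q_def using i2 by simp
  have "(\<Sum>i=1..n. q i) \<le> (\<Sum>i=1..n. 1 + C)" using q by (intro sum_mono) auto
  then show "expectation W \<le> 1 + C" using \<open>1 \<le> n\<close> by (simp add: EW field_simps)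
  have W4: "(W \<omega> - expectation W) ^ 4 = (\<Sum>i=1..n. Y i \<omega>) ^ 4 / real n ^ 4" for \<omega>
    unfolding EW by (simp add: W_def Y_def sum_subtractf diff_divide_distrib flip: power_divide)
  show int4: "integrable M (\<lambda>\<omega>. (W \<omega> - expectation W) ^ 4)"
    unfolding W4 using sum(1) by simp
  have "expectation (\<lambda>\<omega>. (W \<omega> - expectation W) ^ 4) \<le> (3 * (real n)\<^sup>2 * (16 * C)) / real n ^ 4"
    unfolding W4 using sum(2) by (simp add: divide_right_mono)
  also have "\<dots> = 48 * C / (real n)\<^sup>2"
    using \<open>1 \<le> n\<close> by (simp add: field_simps power2_eq_square eval_nat_numeral)
  finally show W4le: "expectation (\<lambda>\<omega>. (W \<omega> - expectation W) ^ 4) \<le> 48 * C / (real n)\<^sup>2" .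
  \<comment> \<open>The variance is at most the root of the fourth central moment, hence of order
    \<open>1 / n\<close>.\<close>
  have "(variance W)\<^sup>2 \<le> expectation (\<lambda>\<omega>. ((W \<omega> - expectation W)\<^sup>2)\<^sup>2)"
    by (rule square_expectation_le) (use iW int4 in auto)
  then have "(variance W)\<^sup>2 \<le> 48 * C / (real n)\<^sup>2" using W4le by simp
  then have "(n * variance W)\<^sup>2 \<le> 48 * C"
    using \<open>1 \<le> n\<close> by (simp add: field_simps)
  then show "n * variance W \<le> sqrt (48 * C)" by (rule real_le_rsqrt)
qed

section \<open>Joint measurability of the speed\<close>

text \<open>The Frechet derivative in direction \<open>1\<close> is the ordinary derivative, and the
  first order of smoothness already contains its continuity.\<close>

lemma continuous_on_deriv_of_smooth_on:
  fixes g g' :: "real \<Rightarrow> real"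
  assumes "smooth_on S g" "\<And>t. t \<in> S \<Longrightarrow> (g has_real_derivative g' t) (at t)"
  shows "continuous_on S g'"
proof -
  have "times_differentiable_on (Suc 0) S g" using assms(1) unfolding smooth_on_def by blast
  then have "continuous_on S (\<lambda>x. frechet_derivative g (at x) 1)" by simp
  moreover have "frechet_derivative g (at t) 1 = g' t" if "t \<in> S" for t
    using frechet_derivative_at[OF assms(2)[OF that, unfolded has_field_derivative_def]]
    by (metis mult.right_neutral)
  ultimately show ?thesis by (simp cong: continuous_on_cong)
qed

text \<open>For an immersion each component of the derivative is measurable in the outcome and
  continuous in time on the open interval. For a mean square smooth process joint measurability is
  part of the choice of version, and only the factors have to be swapped.\<close>

lemma borel_measurable_speed:
  assumes deriv: "immersion_derivative M n X X' \<or> mean_square_smooth_derivative M n X X'"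
    and meas: "\<And>i t. i \<in> {1..n} \<Longrightarrow> t \<in> {0..1} \<Longrightarrow> (\<lambda>\<omega>. X' t \<omega> i) \<in> borel_measurable M"
  shows "(\<lambda>(t, \<omega>). eucl_norm n (X' t \<omega>)) \<in> borel_measurable (lebesgue_on {0..1} \<Otimes>\<^sub>M M)"
proof -
  have comp: "(\<lambda>(t, \<omega>). X' t \<omega> i) \<in> borel_measurable (lebesgue_on {0..1} \<Otimes>\<^sub>M M)"
    if i: "i \<in> {1..n}" for i
    using deriv
  proof
    assume im: "immersion_derivative M n X X'"
    have cont: "continuous_on {0<..<1} (\<lambda>t. X' t \<omega> i)" if "\<omega> \<in> space M" for \<omega>
      using im i that
      by (intro continuous_on_deriv_of_smooth_on[of _ "\<lambda>t. X t \<omega> i"])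
        (auto simp: immersion_derivative_def stochastic_immersion_def sample_path_derivative_def)
    have [measurable]: "(\<lambda>(t, \<omega>). if t \<in> {0<..<1} then X' t \<omega> i else 0) \<in> borel_measurable (borel \<Otimes>\<^sub>M M)"
      using cont meas i by (intro borel_measurable_Caratheodory) auto
    have [measurable]: "(\<lambda>\<omega>. X' 0 \<omega> i) \<in> borel_measurable M" "(\<lambda>\<omega>. X' 1 \<omega> i) \<in> borel_measurable M"
      using meas i by auto
    \<comment> \<open>The end points are patched in by hand, since \<open>X'\<close> is arbitrary
      there and continuity need not extend to them.\<close>
    define G where "G = (\<lambda>x. if fst x = 0 then X' 0 (snd x) i else if fst x = 1 then X' 1 (snd x) i
        else (\<lambda>(t, \<omega>). if t \<in> {0<..<1} then X' t \<omega> i else 0) x)"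
    have G: "G \<in> borel_measurable (borel \<Otimes>\<^sub>M M)" unfolding G_def by measurable
    \<comment> \<open>Every Borel set is Lebesgue measurable, so the identity carries Borel
      measurability in time over to Lebesgue measurability.\<close>
    have "(\<lambda>x. x) \<in> lebesgue_on {0..1::real} \<rightarrow>\<^sub>M borel"
      by (simp add: measurable_completion measurable_restrict_space1)
    then have "(\<lambda>(t, \<omega>). (t, \<omega>)) \<in> lebesgue_on {0..1::real} \<Otimes>\<^sub>M M \<rightarrow>\<^sub>M borel \<Otimes>\<^sub>M M"
      by measurable
    from measurable_compose[OF this G] show ?thesis
      by (rule measurable_cong[THEN iffD1, rotated]) (auto simp: G_def space_pair_measure)
  next
    assume "mean_square_smooth_derivative M n X X'"
    then have "(\<lambda>(\<omega>, t). X' t \<omega>) \<in> M \<Otimes>\<^sub>M lebesgue_on {0..1} \<rightarrow>\<^sub>M borel_Rn n"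
      by (simp add: mean_square_smooth_derivative_def jointly_measurable_def)
    then have "(\<lambda>x. (\<lambda>(\<omega>, t). X' t \<omega>) x i) \<in> borel_measurable (M \<Otimes>\<^sub>M lebesgue_on {0..1})"
      by (rule measurable_compose) (rule measurable_component_singleton[OF i])
    from measurable_compose[OF measurable_pair_swap' this]
    show ?thesis by (simp add: case_prod_beta')
  qed
  have "(\<lambda>x. sqrt (\<Sum>i=1..n. ((\<lambda>(t, \<omega>). X' t \<omega> i) x)\<^sup>2)) \<in> borel_measurable (lebesgue_on {0..1} \<Otimes>\<^sub>M M)"
    using comp by (intro measurable_compose[OF _ borel_measurable_sqrt] borel_measurable_sum borel_measurable_power) auto
  then show ?thesis by (simp add: L2_set_def case_prod_beta')
qed

section \<open>Comparison of the two lengths\<close>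

theorem proposition4p6:
  fixes M :: "'a measure"
    and f f' :: "nat \<Rightarrow> real \<Rightarrow> 'a \<Rightarrow> real"
    and A b :: real
  assumes "prob_space M"
    and "\<And>i t. i \<ge> 1 \<Longrightarrow> t \<in> {0..1} \<Longrightarrow> f i t \<in> borel_measurable M"
    and "\<And>n. n \<ge> 1 \<Longrightarrow> immersion_derivative M n (curve f n) (curve f' n) \<or>
           mean_square_smooth_derivative M n (curve f n) (curve f' n)"
    and "\<And>t. t \<in> {0..1} \<Longrightarrow> prob_space.indep_vars M (\<lambda>_. borel) (\<lambda>i. f' i t) {1..}"
    and "\<And>n. n \<ge> 1 \<Longrightarrow> has_expected_metric M n {0<..<1} (curve f' n)"
    and "\<And>n. n \<ge> 1 \<Longrightarrow> jointly_measurable M n (curve f n)"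
    and "\<And>k::nat. k \<ge> 1 \<Longrightarrow> \<exists>C. \<forall>i\<ge>1. \<forall>t\<in>{0..1}.
           integrable M (\<lambda>\<omega>. f' i t \<omega> ^ k) \<and> \<bar>\<integral>\<omega>. f' i t \<omega> ^ k \<partial>M\<bar> \<le> C"
    and "(INF (n, t)\<in>{1..} \<times> {0..1}. rms_speed M n (curve f' n) t) > 0"
    and "(SUP (n, t)\<in>{1..} \<times> {0..1}. scaled_sd M n (curve f' n) t) < A"
    and "0 < b" and "b < (INF (n, t)\<in>{1..} \<times> {0..1}. rms_speed M n (curve f' n) t)"
  shows "(\<forall>n\<ge>1. expected_length M n (curve f' n) =
            (\<integral>t. (\<integral>\<omega>. eucl_norm n (curve f' n t \<omega>) \<partial>M) \<partial>lebesgue_on {0..1})) \<and>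
         (\<forall>\<^sub>F n in sequentially.
            0 \<le> (expected_metric_length M n (curve f' n) - expected_length M n (curve f' n))
                  / expected_metric_length M n (curve f' n) \<and>
            (expected_metric_length M n (curve f' n) - expected_length M n (curve f' n))
                  / expected_metric_length M n (curve f' n) \<le> A\<^sup>2 / (8 * real n * b ^ 4))"
proof -
  note One_nat_def[simp del]
  interpret prob_space M by fact
  define T where "T = lebesgue_on {0..1::real}"
  have spT: "space T = {0..1}" and measT: "measure T (space T) = 1"
    by (auto simp: T_def measure_restrict_space)
  interpret T: finite_measure T
    unfolding T_def by (rule finite_measure_lebesgue_on) auto
  interpret TM: pair_sigma_finite T M ..
  obtain C where int8: "\<And>i t. 1 \<le> i \<Longrightarrow> t \<in> {0..1} \<Longrightarrow> integrable M (\<lambda>\<omega>. f' i t \<omega> ^ 8)"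
    and le8: "\<And>i t. 1 \<le> i \<Longrightarrow> t \<in> {0..1} \<Longrightarrow> expectation (\<lambda>\<omega>. f' i t \<omega> ^ 8) \<le> C"
    using assms(7)[of 8] by (fastforce dest: abs_le_D1)
  have C: "0 \<le> C"
  proof -
    have "0 \<le> expectation (\<lambda>\<omega>. f' 1 0 \<omega> ^ 8)" by simp
    also have "\<dots> \<le> C" by (intro le8) auto
    finally show ?thesis .
  qed
  \<comment> \<open>The scaling by \<open>sqrt n\<close> in \<open>curve\<close> makes the squared
    speed a mean of \<open>n\<close> squares.\<close>
  define W where "W = (\<lambda>n t \<omega>. (\<Sum>i=1..n. (f' i t \<omega>)\<^sup>2) / real n)"
  have W0: "0 \<le> W n t \<omega>" for n t \<omega> by (auto simp: W_def intro!: divide_nonneg_nonneg sum_nonneg)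
  have norm_W: "eucl_norm n (curve f' n t \<omega>) = sqrt (W n t \<omega>)" for n t \<omega>
    by (simp add: L2_set_def curve_def W_def power_divide sum_divide_distrib)
  define \<mu> where "\<mu> = (\<lambda>n t. expectation (W n t))"
  define l where "l = (\<lambda>n t. expectation (\<lambda>\<omega>. sqrt (W n t \<omega>)))"
  have rms: "rms_speed M n (curve f' n) t = sqrt (\<mu> n t)" for n t
    by (simp add: rms_speed_def norm_W W0 \<mu>_def)
  have sd: "scaled_sd M n (curve f' n) t = sqrt (n * variance (W n t))" for n t
    by (simp add: scaled_sd_def norm_W W0)
  have indep: "indep_vars (\<lambda>_. borel) (\<lambda>i. f' i t) {1..n}" if "t \<in> {0..1}" for n t
    using assms(4)[OF that] by (rule indep_vars_subset) auto
  have W: "integrable M (W n t)" "\<mu> n t \<le> 1 + C"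
    "integrable M (\<lambda>\<omega>. (W n t \<omega> - \<mu> n t) ^ 4)"
    "expectation (\<lambda>\<omega>. (W n t \<omega> - \<mu> n t) ^ 4) \<le> 48 * C / (real n)\<^sup>2"
    "n * variance (W n t) \<le> sqrt (48 * C)" if "1 \<le> n" "t \<in> {0..1}" for n t
    using mean_of_squares_moments[OF indep[OF that(2)] that(1) int8 le8] that
    unfolding W_def \<mu>_def by auto

  \<comment> \<open>Bounds uniform in dimension and time\<close>
  define B where "B = (INF (n, t)\<in>{1..} \<times> {0..1}. rms_speed M n (curve f' n) t)"
  define S where "S = (SUP (n, t)\<in>{1..} \<times> {0..1}. scaled_sd M n (curve f' n) t)"
  have B: "B \<le> sqrt (\<mu> n t)" if "1 \<le> n" "t \<in> {0..1}" for n t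
  proof -
    have "B \<le> (\<lambda>(n, t). rms_speed M n (curve f' n) t) (n, t)"
      unfolding B_def
      by (rule cINF_lower) (use that in \<open>auto simp: rms \<mu>_def W0 intro!: bdd_belowI[of _ 0]\<close>)
    then show ?thesis by (simp add: rms)
  qed
  \<comment> \<open>A supremum of reals bounds its family only if the family is bounded above; the
    uniform variance estimate supplies this.\<close>
  have S: "sqrt (n * variance (W n t)) \<le> S" if "1 \<le> n" "t \<in> {0..1}" for n t
  proof -
    have "(\<lambda>(n, t). scaled_sd M n (curve f' n) t) (n, t) \<le> S"
      unfolding S_def
      by (rule cSUP_upper)
        (use that W(5) in \<open>auto simp: sd intro!: bdd_aboveI[of _ "sqrt (sqrt (48 * C))"]\<close>)
    then show ?thesis by (simp add: sd)
  qed
  have "0 < b" "b < B" "S < A" using assms by (auto simp: B_def S_def)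
  have "0 \<le> S" using S[of 1 0] by (rule order_trans[rotated]) auto
  have B_le: "B\<^sup>2 \<le> \<mu> n t" if "1 \<le> n" "t \<in> {0..1}" for n t
    using power_mono[OF B[OF that], of 2] \<open>0 < b\<close> \<open>b < B\<close> by (simp add: \<mu>_def W0)
  have var: "variance (W n t) \<le> S\<^sup>2 / n" if "1 \<le> n" "t \<in> {0..1}" for n t
    using sqrt_le_D[OF S[OF that]] that by (simp add: field_simps)

  \<comment> \<open>Integrability in time and exchange of integrals\<close>
  have meas: "(\<lambda>(t, \<omega>). sqrt (W n t \<omega>)) \<in> borel_measurable (T \<Otimes>\<^sub>M M)" if "1 \<le> n" for n
  proof -
    have "(\<lambda>\<omega>. curve f' n t \<omega> i) \<in> borel_measurable M" if "i \<in> {1..n}" "t \<in> {0..1}" for i t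
    proof -
      have [measurable]: "f' i t \<in> borel_measurable M"
        using assms(4)[OF that(2)] that(1) by (auto simp: indep_vars_def)
      show ?thesis using that(1) by (simp add: curve_def)
    qed
    from borel_measurable_speed[OF assms(3)[OF \<open>1 \<le> n\<close>] this] show ?thesis
      by (simp add: norm_W T_def)
  qed
  have \<mu>_meas: "\<mu> n \<in> borel_measurable T" if "1 \<le> n" for n
  proof -
    \<comment> \<open>Squaring the jointly measurable speed recovers \<open>W\<close>, whose
      integral over the outcome is then measurable in time.\<close>
    have "(\<lambda>x. ((\<lambda>(t, \<omega>). sqrt (W n t \<omega>)) x)\<^sup>2) \<in> borel_measurable (T \<Otimes>\<^sub>M M)"
      using meas[OF that] by (rule borel_measurable_power)
    then have "(\<lambda>(t, \<omega>). W n t \<omega>) \<in> borel_measurable (T \<Otimes>\<^sub>M M)"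
      by (simp add: case_prod_beta' W0)
    then show ?thesis unfolding \<mu>_def by (rule borel_measurable_lebesgue_integral)
  qed
  have l_le: "l n t \<le> sqrt (\<mu> n t)" if "1 \<le> n" "t \<in> {0..1}" for n t
    unfolding l_def \<mu>_def using W(1)[OF that] W0 by (rule expectation_sqrt_le)
  have l0: "0 \<le> l n t" for n t by (simp add: l_def W0)
  have int_m: "integrable T (\<lambda>t. sqrt (\<mu> n t))" if "1 \<le> n" for n
  proof (rule T.integrable_const_bound[where B="sqrt (1 + C)"])
    show "AE t in T. norm (sqrt (\<mu> n t)) \<le> sqrt (1 + C)"
      using W(2)[OF that] by (intro AE_I2) (auto simp: spT \<mu>_def W0)
    show "(\<lambda>t. sqrt (\<mu> n t)) \<in> borel_measurable T" using \<mu>_meas[OF that] by measurable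
  qed
  have int_l: "integrable T (l n)" if "1 \<le> n" for n
  proof (rule Bochner_Integration.integrable_bound[OF int_m[OF that]])
    show "l n \<in> borel_measurable T"
      unfolding l_def using meas[OF that] by (rule borel_measurable_lebesgue_integral)
    show "AE t in T. norm (l n t) \<le> norm (sqrt (\<mu> n t))"
      using l_le[OF that] l0 by (intro AE_I2) (auto simp: spT \<mu>_def W0)
  qed
  have el: "expected_length M n (curve f' n) = (\<integral>t. l n t \<partial>T)" if "1 \<le> n" for n
  proof -
    \<comment> \<open>The integrand is nonnegative, so the inner integral of its norm is
      \<open>l n\<close> itself, already known to be integrable.\<close>
    have "integrable (T \<Otimes>\<^sub>M M) (\<lambda>(t, \<omega>). sqrt (W n t \<omega>))"
    proof (rule TM.Fubini_integrable[OF meas[OF that]])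
      show "integrable T (\<lambda>t. \<integral>\<omega>. norm (case (t, \<omega>) of (t, \<omega>) \<Rightarrow> sqrt (W n t \<omega>)) \<partial>M)"
        using int_l[OF that] by (simp add: l_def W0)
      show "AE t in T. integrable M (\<lambda>\<omega>. case (t, \<omega>) of (t, \<omega>) \<Rightarrow> sqrt (W n t \<omega>))"
        using W(1)[OF that] W0 by (intro AE_I2) (auto simp: spT intro!: integrable_sqrt)
    qed
    then have "(\<integral>\<omega>. (\<integral>t. sqrt (W n t \<omega>) \<partial>T) \<partial>M) = (\<integral>t. l n t \<partial>T)"
      unfolding l_def by (rule TM.Fubini_integral)
    then show ?thesis by (simp add: expected_length_def norm_W T_def)
  qed
  have eml: "expected_metric_length M n (curve f' n) = (\<integral>t. sqrt (\<mu> n t) \<partial>T)" for n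
    by (simp add: expected_metric_length_def norm_W W0 \<mu>_def T_def)

  \<comment> \<open>Choice of constants and the pointwise estimate\<close>
  \<comment> \<open>\<open>g\<close> is the room left by \<open>b < B\<close> and
    \<open>S < A\<close>; half of it will pay for \<open>e\<close> and half for the quartic
    remainder.\<close>
  define g where "g = A\<^sup>2 / (8 * b ^ 4) - S\<^sup>2 / (8 * B ^ 4)"
  have "0 < g"
  proof -
    have "S\<^sup>2 / (8 * B ^ 4) \<le> S\<^sup>2 / (8 * b ^ 4)"
      using \<open>0 < b\<close> \<open>b < B\<close> by (intro divide_left_mono) (auto intro!: power_mono)
    also have "\<dots> < A\<^sup>2 / (8 * b ^ 4)"
      using \<open>0 < b\<close> \<open>0 \<le> S\<close> \<open>S < A\<close> by (intro divide_strict_right_mono power_strict_mono) auto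
    finally show ?thesis by (simp add: g_def)
  qed
  \<comment> \<open>Chosen so that \<open>e * (S^2 / B^4) \<le> g / 2\<close>; the added 1 keeps the
    denominator positive even if \<open>S = 0\<close>.\<close>
  define e where "e = g / (2 * (S\<^sup>2 / B ^ 4 + 1))"
  have pos: "0 < S\<^sup>2 / B ^ 4 + 1" by (intro add_nonneg_pos) auto
  then have "0 < e" using \<open>0 < g\<close> by (simp add: e_def)
  have "e * (S\<^sup>2 / B ^ 4 + 1) = g / 2" using pos by (simp add: e_def field_simps)
  then have e: "e * (S\<^sup>2 / B ^ 4) \<le> g / 2" using \<open>0 < e\<close> by (simp add: algebra_simps)
  \<comment> \<open>\<open>K / n^2\<close> bounds the quartic term, and \<open>\<delta> n\<close>
    bounds the relative loss \<open>1 - l n t / sqrt (\<mu> n t)\<close> by a quantity free of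
    \<open>t\<close>.\<close>
  define K where "K = 48 * C / (16 * e * B ^ 8)"
  define \<delta> where "\<delta> = (\<lambda>n. ((1/8 + e) * (S\<^sup>2 / B ^ 4) + K / real n) / real n)"
  have l_ge: "sqrt (\<mu> n t) * (1 - \<delta> n) \<le> l n t" if nt: "1 \<le> n" "t \<in> {0..1}" for n t
  proof -
    have "0 < B" using \<open>0 < b\<close> \<open>b < B\<close> by simp
    then have \<mu>: "0 < B\<^sup>2" "B\<^sup>2 \<le> \<mu> n t" using B_le[OF nt] by auto
    then have \<mu>0: "0 < \<mu> n t" by (rule less_le_trans)
    have \<mu>2: "B ^ 4 \<le> (\<mu> n t)\<^sup>2" using power_mono[OF \<mu>(2), of 2] by simp
    have \<mu>4: "B ^ 8 \<le> \<mu> n t ^ 4" using power_mono[OF \<mu>(2), of 4] by simp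
    have "(1/8 + e) * variance (W n t) / (\<mu> n t)\<^sup>2 \<le> (1/8 + e) * (S\<^sup>2 / n) / B ^ 4"
      using var[OF nt] \<mu>2 \<open>0 < B\<close> \<open>0 < e\<close> by (intro frac_le mult_left_mono) auto
    moreover have "expectation (\<lambda>\<omega>. (W n t \<omega> - \<mu> n t) ^ 4) / (16 * e * \<mu> n t ^ 4) \<le>
        48 * C / (real n)\<^sup>2 / (16 * e * B ^ 8)"
      using W(4)[OF nt] \<mu>4 \<open>0 < B\<close> \<open>0 < e\<close> C by (intro frac_le mult_left_mono) auto
    moreover have "\<delta> n = (1/8 + e) * (S\<^sup>2 / n) / B ^ 4 + 48 * C / (real n)\<^sup>2 / (16 * e * B ^ 8)"
      by (simp add: \<delta>_def K_def add_divide_distrib power2_eq_square mult_ac)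
    ultimately have "1 - \<delta> n \<le> 1 - (1/8 + e) * variance (W n t) / (\<mu> n t)\<^sup>2 -
        expectation (\<lambda>\<omega>. (W n t \<omega> - \<mu> n t) ^ 4) / (16 * e * \<mu> n t ^ 4)" by linarith
    then have "sqrt (\<mu> n t) * (1 - \<delta> n) \<le> sqrt (\<mu> n t) * (1 - (1/8 + e) * variance (W n t) / (\<mu> n t)\<^sup>2 -
        expectation (\<lambda>\<omega>. (W n t \<omega> - \<mu> n t) ^ 4) / (16 * e * \<mu> n t ^ 4))"
      using \<mu>0 by (intro mult_left_mono) auto
    also have "\<dots> \<le> l n t"
      unfolding l_def \<mu>_def
      by (rule expectation_sqrt_ge) (use W(1,3)[OF nt] W0 \<mu>0 \<open>0 < e\<close> in \<open>auto simp: \<mu>_def\<close>)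
    finally show ?thesis .
  qed

  \<comment> \<open>Integration over time and large dimensions\<close>
  have bound: "0 \<le> (L - l') / L \<and> (L - l') / L \<le> \<delta> n"
    if n: "1 \<le> n" and L: "L = (\<integral>t. sqrt (\<mu> n t) \<partial>T)" "l' = (\<integral>t. l n t \<partial>T)" for n L l'
  proof -
    \<comment> \<open>The unit interval has measure 1, so \<open>L \<ge> b > 0\<close> and the
      quotient is a genuine one.\<close>
    have "(\<integral>t. b \<partial>T) \<le> L"
      unfolding L by (rule integral_mono[OF _ int_m[OF n]]) (use B[OF n] \<open>b < B\<close> in \<open>fastforce simp: spT\<close>)+
    then have "0 < L" using \<open>0 < b\<close> measT by simp
    moreover have "l' \<le> L"
      unfolding L by (rule integral_mono[OF int_l[OF n] int_m[OF n]]) (simp add: spT l_le[OF n])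
    moreover have "(\<integral>t. sqrt (\<mu> n t) * (1 - \<delta> n) \<partial>T) \<le> l'"
      unfolding L using int_m[OF n] int_l[OF n] l_ge[OF n] by (intro integral_mono) (auto simp: spT)
    then have "L * (1 - \<delta> n) \<le> l'" by (simp add: L(1))
    ultimately show ?thesis by (simp add: field_simps)
  qed
  \<comment> \<open>The threshold \<open>2 * K / g\<close> is where \<open>K / n\<close> drops to
    \<open>g / 2\<close>.\<close>
  have "\<forall>\<^sub>F n in sequentially. 1 \<le> n \<and> 2 * K / g \<le> real n"
    by (intro eventually_conj eventually_ge_at_top
        eventually_compose_filterlim[OF eventually_ge_at_top filterlim_real_sequentially])
  then have "\<forall>\<^sub>F n in sequentially.
      0 \<le> (expected_metric_length M n (curve f' n) - expected_length M n (curve f' n))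
            / expected_metric_length M n (curve f' n) \<and>
      (expected_metric_length M n (curve f' n) - expected_length M n (curve f' n))
            / expected_metric_length M n (curve f' n) \<le> A\<^sup>2 / (8 * real n * b ^ 4)"
  proof eventually_elim
    case (elim n)
    have Kn: "K / n \<le> g / 2" using elim \<open>0 < g\<close> by (simp add: field_simps)
    \<comment> \<open>The two halves of \<open>g\<close> add up to exactly the gap between the
      constants for \<open>(S, B)\<close> and \<open>(A, b)\<close>.\<close>
    have "(1/8 + e) * (S\<^sup>2 / B ^ 4) + K / n \<le> A\<^sup>2 / (8 * b ^ 4)"
    proof -
      have "(1/8 + e) * (S\<^sup>2 / B ^ 4) = S\<^sup>2 / (8 * B ^ 4) + e * (S\<^sup>2 / B ^ 4)"
        by (simp add: distrib_right add_divide_distrib)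
      then show ?thesis using Kn e g_def by linarith
    qed
    then have "\<delta> n \<le> A\<^sup>2 / (8 * b ^ 4) / n"
      unfolding \<delta>_def by (rule divide_right_mono) simp
    also have "\<dots> = A\<^sup>2 / (8 * real n * b ^ 4)" by (simp add: field_simps)
    finally show ?case using bound[OF _ eml el] elim by fastforce
  qed
  then show ?thesis using el by (auto simp: l_def norm_W T_def)
qed

end
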